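(* Let $\ell\ge 1$ and $r\ge 0$. There is a bijection $\Phi$ from the set $\mathcal A_{\ell,r}$ of sequences $\mathbf a=(a_1,\ldots,a_\ell)$ of nonnegative integers with $\operatorname{exc}(\mathbf a)=r$ to the set $\mathcal D_{\ell,r}$ of labeled Dyck paths of semilength $\ell$ with total label sum $r$, such that, whenever $\mathbf a\in\mathcal A_{\ell,r}$ and $(\pi,\lambda)=\Phi(\mathbf a)$, \[ \operatorname{asc}(\mathbf a)=\operatorname{pk}(\pi)-1,\qquad \operatorname{lev}(\mathbf a)=\operatorname{lv}(\pi,\lambda),\qquad \operatorname{rlmin}(\mathbf a)=\operatorname{ret}(\pi), \] and moreover the label of the initial up step of $\pi$ is $\min\{a_1,\ldots,a_\ell\}$. Consequently, \[ |\mathcal A_{\ell,r}|=C_\ell\binom{r+\ell-1}{\ell-1}, \] where $C_\ell=\frac1{\ell+1}\binom{2\ell}{\ell}$ is the Catalan number.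
   Context: Write $(n)_+=\max\{n,0\}$. For a sequence $\mathbf a=(a_1,\ldots,a_\ell)$ of nonnegative integers: $\operatorname{exc}(\mathbf a)=a_1+\sum_{j=2}^{\ell}(a_j-a_{j-1}-1)_+$; $\operatorname{asc}(\mathbf a)=|\{j:1\le j<\ell,\ a_j<a_{j+1}\}|$; $\operatorname{lev}(\mathbf a)=|\{j:1\le j<\ell,\ a_j=a_{j+1}\}|$; $\operatorname{rlmin}(\mathbf a)$ is the number of strict right-to-left minima, i.e. of indices $i$ with $a_i<a_j$ for all $j>i$. A Dyck path of semilength $\ell$ is a lattice path from $(0,0)$ to $(2\ell,0)$ with steps $U=(1,1)$, $D=(1,-1)$ that never goes below the horizontal axis; $\epsilon$ is the empty path. $\operatorname{pk}(\pi)$ is the number of peaks (consecutive steps $UD$), and $\operatorname{ret}(\pi)$ is the number of returns (down steps ending on the horizontal axis). A nonempty Dyck path is primitive if it has exactly one return. A labeled Dyck path is a pair $(\pi,\lambda)$ with $\pi$ a Dyck path of semilength $\ell$ and $\lambda=(\lambda_1,\ldots,\lambda_\ell)$ a sequence of nonnegative integers, $\lambda_i$ being the label of the $i$th up step from left to right; its total label sum is $|\lambda|=\lambda_1+\cdots+\lambda_\ell$. The statistic $\operatorname{lv}$ is defined recursively: $\operatorname{lv}=0$ on the empty path; for a nonempty labeled path with first-return decomposition $\pi=U\pi_LD\pi_R$ ($\pi_L,\pi_R$ Dyck paths) and induced labelings $\lambda_L,\lambda_R$, one has $\operatorname{lv}(\pi,\lambda)=\operatorname{lv}(\pi_L,\lambda_L)+\operatorname{lv}(\pi_R,\lambda_R)+\delta(\pi_L,\lambda_L)$,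 where $\delta(\pi_L,\lambda_L)=1$ if $\pi_L$ is nonempty and primitive and its initial up step has label $0$, and $\delta(\pi_L,\lambda_L)=0$ otherwise. (Equivalently, $\operatorname{lv}(\pi,\lambda)$ is the number of factors $UU\sigma DD$ of $\pi$, with $\sigma$ a possibly empty Dyck path, whose second up step is labeled $0$.) *)

theory Defs
  imports Complex_Main
begin

text \<open>A sequence \<open>(a\<^sub>1, \<dots>, a\<^sub>l)\<close> of nonnegative integers is a list \<open>a\<close> of length \<open>l\<close>,
  with \<open>a\<^sub>i\<close> represented by \<open>a ! (i - 1)\<close>.\<close>

text \<open>Subtraction on \<^typ>\<open>nat\<close> truncates at \<open>0\<close>, so each summand below is the positive part
  \<open>(a\<^sub>j - a\<^sub>j\<^sub>-\<^sub>1 - 1)\<^sub>+\<close>.\<close>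

definition exc :: "nat list \<Rightarrow> nat" where
  "exc a = a ! 0 + (\<Sum>j = 1..<length a. a ! j - a ! (j - 1) - 1)"

definition asc :: "nat list \<Rightarrow> nat" where
  "asc a = card {j. Suc j < length a \<and> a ! j < a ! Suc j}"

definition lev :: "nat list \<Rightarrow> nat" where
  "lev a = card {j. Suc j < length a \<and> a ! j = a ! Suc j}"

definition rlmin :: "nat list \<Rightarrow> nat" where
  "rlmin a = card {i. i < length a \<and> (\<forall>j. i < j \<and> j < length a \<longrightarrow> a ! i < a ! j)}"

definition exc_seqs :: "nat \<Rightarrow> nat \<Rightarrow> nat list set" where
  "exc_seqs l r = {a. length a = l \<and> exc a = r}"

datatype step = U | D

fun step_height :: "step \<Rightarrow> int" where
  "step_height U = 1"
| "step_height D = - 1"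

definition height :: "step list \<Rightarrow> int" where
  "height p = sum_list (map step_height p)"

definition dyck :: "step list \<Rightarrow> bool" where
  "dyck p \<longleftrightarrow> (\<forall>k \<le> length p. 0 \<le> height (take k p)) \<and> height p = 0"

definition dyck_paths :: "nat \<Rightarrow> step list set" where
  "dyck_paths l = {p. dyck p \<and> length p = 2 * l}"

definition pk :: "step list \<Rightarrow> nat" where
  "pk p = card {i. Suc i < length p \<and> p ! i = U \<and> p ! Suc i = D}"

definition ret :: "step list \<Rightarrow> nat" where
  "ret p = card {i. i < length p \<and> p ! i = D \<and> height (take (Suc i) p) = 0}"

definition primitive :: "step list \<Rightarrow> bool" where
  "primitive p \<longleftrightarrow> p \<noteq> [] \<and> ret p = 1"

definition labeled_dyck_paths :: "nat \<Rightarrow> nat \<Rightarrow> (step list \<times> nat list) set" where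
  "labeled_dyck_paths l r =
     {(p, lam). p \<in> dyck_paths l \<and> length lam = l \<and> sum_list lam = r}"

text \<open>First-return decomposition \<open>p = U p\<^sub>L D p\<^sub>R\<close> of a nonempty Dyck path
  (characterised by \<open>fr_decomposition\<close> below).\<close>

definition first_return :: "step list \<Rightarrow> nat" where
  "first_return p = (LEAST k. 0 < k \<and> height (take k p) = 0)"

definition fr_left :: "step list \<Rightarrow> step list" where
  "fr_left p = take (first_return p - 2) (tl p)"

definition fr_right :: "step list \<Rightarrow> step list" where
  "fr_right p = drop (first_return p) p"

text \<open>The labels are listed in the order of the up steps: first the label of the initial up step,
  then those of \<open>p\<^sub>L\<close> (as many as the semilength of \<open>p\<^sub>L\<close>), then those of \<open>p\<^sub>R\<close>.\<close>

definition lab_left :: "step list \<Rightarrow> nat list \<Rightarrow> nat list" where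
  "lab_left p lam = take (length (fr_left p) div 2) (tl lam)"

definition lab_right :: "step list \<Rightarrow> nat list \<Rightarrow> nat list" where
  "lab_right p lam = drop (length (fr_left p) div 2) (tl lam)"

definition lv_delta :: "step list \<Rightarrow> nat list \<Rightarrow> nat" where
  "lv_delta p lam = (if p \<noteq> [] \<and> primitive p \<and> lam ! 0 = 0 then 1 else 0)"

lemma first_return_pos:
  assumes "dyck p" "p \<noteq> []"
  shows "0 < first_return p"
proof -
  have "0 < length p \<and> height (take (length p) p) = 0"
    using assms by (simp add: dyck_def)
  then have "0 < first_return p \<and> height (take (first_return p) p) = 0"
    unfolding first_return_def by (rule LeastI)
  then show ?thesis by simp
qed

text \<open>The value on words that are not Dyck paths is a dummy.\<close>

function lv :: "step list \<Rightarrow> nat list \<Rightarrow> nat" where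
  "lv p lam =
     (if dyck p \<and> p \<noteq> []
      then lv (fr_left p) (lab_left p lam) + lv (fr_right p) (lab_right p lam)
             + lv_delta (fr_left p) (lab_left p lam)
      else 0)"
  by pat_completeness auto
termination
proof (relation "measure (\<lambda>(p, lam). length p)", goal_cases)
  case 1
  show ?case by simp
next
  case (2 p lam)
  then show ?case by (cases p) (auto simp: fr_left_def)
next
  case (3 p lam)
  then show ?case using first_return_pos[of p] by (simp add: fr_right_def)
qed

declare lv.simps [simp del]

lemma height_simps [simp]:
  "height [] = 0"
  "height (s # p) = step_height s + height p"
  "height (p @ q) = height p + height q"
  by (simp_all add: height_def)

lemma dyck_compose:
  assumes "dyck p" "dyck q"
  shows "dyck (U # p @ D # q)"
  unfolding dyck_def
proof (intro conjI allI impI)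
  fix k assume "k \<le> length (U # p @ D # q)"
  show "0 \<le> height (take k (U # p @ D # q))"
  proof (cases k)
    case (Suc m)
    show ?thesis
    proof (cases "m \<le> length p")
      case True
      then show ?thesis using assms Suc by (simp add: dyck_def)
    next
      case False
      then obtain n where n: "m = length p + Suc n"
        by (metis add_Suc_right less_imp_Suc_add not_le)
      have "n \<le> length q" using \<open>k \<le> _\<close> Suc n by simp
      then show ?thesis using assms Suc n by (simp add: dyck_def)
    qed
  qed simp
qed (use assms in \<open>simp add: dyck_def\<close>)

lemma first_return_compose:
  assumes "dyck p"
  shows "first_return (U # p @ D # q) = length p + 2"
  unfolding first_return_def
proof (rule Least_equality)
  show "0 < length p + 2 \<and> height (take (length p + 2) (U # p @ D # q)) = 0"
    using assms by (simp add: dyck_def)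
next
  fix k assume k: "0 < k \<and> height (take k (U # p @ D # q)) = 0"
  show "length p + 2 \<le> k"
  proof (rule ccontr)
    assume "\<not> length p + 2 \<le> k"
    with k obtain m where "k = Suc m" "m \<le> length p" by (cases k) auto
    with k assms show False by (force simp: dyck_def)
  qed
qed

lemma fr_decomposition:
  assumes "dyck p"
  shows "fr_left (U # p @ D # q) = p" "fr_right (U # p @ D # q) = q"
  using first_return_compose[OF assms, of q] by (simp_all add: fr_left_def fr_right_def)

lemma lv_Nil: "lv [] lam = 0"
  by (simp add: lv.simps)

lemma lv_compose:
  assumes "dyck p" "dyck q" "length p = 2 * length mu"
  shows "lv (U # p @ D # q) (x # mu @ nu) = lv p mu + lv q nu + lv_delta p mu"
  by (subst lv.simps)
     (simp add: assms dyck_compose fr_decomposition lab_left_def lab_right_def)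

definition catalan :: "nat \<Rightarrow> rat" where
  "catalan l = 1 / of_nat (l + 1) * of_nat ((2 * l) choose l)"

end

theory Submission
  imports "HOL-Library.Tree" Defs
begin

text \<open>Let \<open>m\<close> be the minimum of a nonempty sequence and cut at its last occurrence:
  \<open>a = b m c\<close> with \<open>b \<ge> m\<close> and \<open>c > m\<close>. Then \<open>exc a = m + exc (b - m) + exc (c - m - 1)\<close>, so
  recursively sequences correspond to binary trees with a label at each node (\<open>m\<close> at the root,
  \<open>b - m\<close> on the left, \<open>c - m - 1\<close> on the right), \<open>exc\<close> being the sum of the labels. The
  first-return decomposition \<open>U \<pi>\<^sub>L D \<pi>\<^sub>R\<close> identifies the same trees with labeled Dyck paths.
  The junction of \<open>b\<close> and \<open>m\<close> is a level iff \<open>b - m\<close> ends in \<open>0\<close>, that is, iff \<open>\<pi>\<^sub>L\<close> is primitive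
  with initial label \<open>0\<close>.\<close>

section \<open>Statistics of sequences\<close>

text \<open>Ascents, levels and peaks all count neighbouring pairs in some relation, so one rule for
  \<open>#\<close> and one for \<open>@\<close> serve all three.\<close>

definition adj_count :: "('a \<Rightarrow> 'a \<Rightarrow> bool) \<Rightarrow> 'a list \<Rightarrow> nat" where
  "adj_count P xs = card {j. Suc j < length xs \<and> P (xs ! j) (xs ! Suc j)}"

lemma asc_eq_adj_count: "asc = adj_count (<)"
  by (simp add: fun_eq_iff asc_def adj_count_def)

lemma lev_eq_adj_count: "lev = adj_count (=)"
  by (simp add: fun_eq_iff lev_def adj_count_def)

lemma pk_eq_adj_count: "pk = adj_count (\<lambda>s t. s = U \<and> t = D)"
  by (simp add: fun_eq_iff pk_def adj_count_def)

text \<open>Splitting off index 0 turns statistics defined by index sets into recursions on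
  \<open>#\<close>.\<close>

lemma card_less_Suc_split:
  "card {i. i < Suc n \<and> Q i} = (if Q 0 then 1 else 0) + card {i. i < n \<and> Q (Suc i)}"
proof -
  have "{i. i < Suc n \<and> Q i} = (if Q 0 then {0} else {}) \<union> Suc ` {i. i < n \<and> Q (Suc i)}"
    by (auto simp: less_Suc_eq_0_disj)
  also have "card \<dots> = card (if Q 0 then {0::nat} else {}) + card (Suc ` {i. i < n \<and> Q (Suc i)})"
    by (rule card_Un_disjoint) auto
  finally show ?thesis
    by (simp add: card_image)
qed

lemma adj_count_Nil [simp]: "adj_count P [] = 0"
  by (simp add: adj_count_def)

lemma adj_count_Cons:
  "adj_count P (x # xs) = (if xs \<noteq> [] \<and> P x (hd xs) then 1 else 0) + adj_count P xs"
proof (cases xs)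
  case (Cons y ys)
  then show ?thesis
    using card_less_Suc_split[of "length ys" "\<lambda>j. P ((x # xs) ! j) ((x # xs) ! Suc j)"]
    by (simp add: adj_count_def)
qed (simp add: adj_count_def)

lemma adj_count_append:
  "adj_count P (xs @ ys) = adj_count P xs + adj_count P ys
     + (if xs \<noteq> [] \<and> ys \<noteq> [] \<and> P (last xs) (hd ys) then 1 else 0)"
  by (induction xs) (auto simp: adj_count_Cons hd_append)

lemma adj_count_map: "adj_count P (map f xs) = adj_count (\<lambda>x y. P (f x) (f y)) xs"
  by (induction xs) (auto simp: adj_count_Cons hd_map)

lemma rlmin_Nil [simp]: "rlmin [] = 0"
  by (simp add: rlmin_def)

lemma rlmin_Cons: "rlmin (x # xs) = (if \<forall>y \<in> set xs. x < y then 1 else 0) + rlmin xs"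
proof -
  have 0: "(\<forall>j. 0 < j \<and> j < Suc (length xs) \<longrightarrow> x < (x # xs) ! j) \<longleftrightarrow> (\<forall>y \<in> set xs. x < y)"
    by (auto simp: all_set_conv_all_nth gr0_conv_Suc)
  have Suc: "(\<forall>j. Suc i < j \<and> j < Suc (length xs) \<longrightarrow> xs ! i < (x # xs) ! j)
      \<longleftrightarrow> (\<forall>j. i < j \<and> j < length xs \<longrightarrow> xs ! i < xs ! j)" for i
  proof
    assume *: "\<forall>j. Suc i < j \<and> j < Suc (length xs) \<longrightarrow> xs ! i < (x # xs) ! j"
    then show "\<forall>j. i < j \<and> j < length xs \<longrightarrow> xs ! i < xs ! j"
      by (metis Suc_less_eq nth_Cons_Suc)
  next
    assume *: "\<forall>j. i < j \<and> j < length xs \<longrightarrow> xs ! i < xs ! j"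
    then show "\<forall>j. Suc i < j \<and> j < Suc (length xs) \<longrightarrow> xs ! i < (x # xs) ! j"
      by (auto simp: Suc_less_eq2)
  qed
  show ?thesis
    unfolding rlmin_def length_Cons card_less_Suc_split
    by (simp only: nth_Cons_0 nth_Cons_Suc 0 Suc)
qed

lemma rlmin_map_add: "rlmin (map (\<lambda>y. y + k) xs) = rlmin xs"
  by (induction xs) (auto simp: rlmin_Cons)

text \<open>No entry of \<open>ys\<close> is a right-to-left minimum, because the later
  \<open>m\<close> is no larger; \<open>m\<close> is one, because everything after it exceeds
  it.\<close>

lemma rlmin_append_min:
  assumes "\<forall>y \<in> set ys. m \<le> y" "\<forall>z \<in> set zs. m < z"
  shows "rlmin (ys @ m # zs) = Suc (rlmin zs)"
  using assms by (induction ys) (auto simp: rlmin_Cons)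

text \<open>The excess of a sequence that continues one ending in \<open>k - 1\<close>; the value \<open>k = 0\<close> makes
  the first summand the first entry itself.\<close>

fun exc_from :: "nat \<Rightarrow> nat list \<Rightarrow> nat" where
  "exc_from k [] = 0"
| "exc_from k (x # xs) = (x - k) + exc_from (Suc x) xs"

text \<open>In truncated subtraction \<open>x - Suc k = x - k - 1\<close>, so the argument
  \<open>Suc k\<close> acts as a preceding entry \<open>k\<close>.\<close>

lemma exc_from_Suc:
  "exc_from (Suc k) xs = (\<Sum>j = 1..<Suc (length xs). (k # xs) ! j - (k # xs) ! (j - 1) - 1)"
proof (induction xs arbitrary: k)
  case (Cons x xs)
  have "(\<Sum>j = 1..<Suc (length (x # xs)). (k # x # xs) ! j - (k # x # xs) ! (j - 1) - 1)
      = (x - k - 1)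
        + (\<Sum>j = Suc 1..<Suc (Suc (length xs)). (k # x # xs) ! j - (k # x # xs) ! (j - 1) - 1)"
    by (subst sum.atLeast_Suc_lessThan) auto
  also have "(\<Sum>j = Suc 1..<Suc (Suc (length xs)). (k # x # xs) ! j - (k # x # xs) ! (j - 1) - 1)
      = (\<Sum>j = 1..<Suc (length xs). (x # xs) ! j - (x # xs) ! (j - 1) - 1)"
    unfolding sum.shift_bounds_Suc_ivl by (rule sum.cong) (auto simp: nth_Cons')
  finally show ?case
    using Cons.IH[of x] by simp
qed simp

lemma exc_eq_exc_from: "xs \<noteq> [] \<Longrightarrow> exc xs = exc_from 0 xs"
  by (cases xs) (simp_all add: exc_def exc_from_Suc)

lemma exc_from_append:
  "exc_from k (xs @ ys) = exc_from k xs + exc_from (if xs = [] then k else Suc (last xs)) ys"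
  by (induction xs arbitrary: k) auto

lemma exc_from_map_add: "exc_from (k + m) (map (\<lambda>y. y + m) xs) = exc_from k xs"
proof (induction xs arbitrary: k)
  case (Cons x xs)
  then show ?case
    using Cons.IH[of "Suc x"] by simp
qed simp

text \<open>Only the first summand of the excess sees a common shift; the others depend on
  differences of neighbours.\<close>

lemma exc_from_0_map_add: "xs \<noteq> [] \<Longrightarrow> exc_from 0 (map (\<lambda>y. y + m) xs) = m + exc_from 0 xs"
  using exc_from_map_add[of "Suc (hd xs)" m "tl xs"] by (cases xs) simp_all

section \<open>Trees and sequences\<close>

fun seq_of :: "nat tree \<Rightarrow> nat list" where
  "seq_of \<langle>\<rangle> = []"
| "seq_of \<langle>l, x, r\<rangle> = map (\<lambda>y. y + x) (seq_of l) @ x # map (\<lambda>y. y + Suc x) (seq_of r)"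

lemma length_seq_of [simp]: "length (seq_of t) = size t"
  by (induction t) auto

lemma seq_of_eq_Nil_iff [simp]: "seq_of t = [] \<longleftrightarrow> t = \<langle>\<rangle>"
  by (cases t) auto

text \<open>If the left block is empty, the root contributes \<open>x\<close> itself. Otherwise the
  shift of that block contributes \<open>x\<close>, and the step to the root adds nothing, since the
  block ends in an entry at least \<open>x\<close>. After the root, the threshold
  \<open>Suc x\<close> cancels the shift of the right block.\<close>

lemma exc_from_seq_of: "exc_from 0 (seq_of t) = sum_list (preorder t)"
proof (induction t)
  case (Node l x r)
  have "exc_from (Suc x) (map (\<lambda>y. Suc (y + x)) (seq_of r)) = exc_from 0 (seq_of r)"
    using exc_from_map_add[of 0 "Suc x"] by simp
  with Node show ?case
    by (cases "l = \<langle>\<rangle>") (auto simp: exc_from_append exc_from_0_map_add last_map)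
qed simp

lemma exc_seq_of: "t \<noteq> \<langle>\<rangle> \<Longrightarrow> exc (seq_of t) = sum_list (preorder t)"
  by (simp add: exc_eq_exc_from exc_from_seq_of)

lemma Min_seq_of: "Min (set (seq_of \<langle>l, x, r\<rangle>)) = x"
  by (rule Min_eqI) auto

text \<open>Both sides cut the same list at the last occurrence of \<open>x\<close>, which is
  unique.\<close>

lemma append_Cons_last_eq:
  assumes "xs @ x # ys = xs' @ x # ys'" "x \<notin> set ys" "x \<notin> set ys'"
  shows "xs = xs' \<and> ys = ys'"
  using assms by (auto simp: append_eq_append_conv2 Cons_eq_append_conv append_eq_Cons_conv)

lemma inj_seq_of: "inj seq_of"
proof (rule injI)
  fix s t show "seq_of s = seq_of t \<Longrightarrow> s = t"
  proof (induction s arbitrary: t)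
    case Leaf
    then show ?case by (metis seq_of_eq_Nil_iff)
  next
    case (Node l x r)
    obtain l' x' r' where t: "t = \<langle>l', x', r'\<rangle>"
      using Node.prems by (cases t) auto
    have x: "x = x'"
      using Node.prems t Min_seq_of by metis
    \<comment> \<open>The right blocks lie strictly above \<open>x\<close>, so on both sides the
      root is the last occurrence of the minimum.\<close>
    have "map (\<lambda>y. y + x) (seq_of l) = map (\<lambda>y. y + x) (seq_of l')
        \<and> map (\<lambda>y. y + Suc x) (seq_of r) = map (\<lambda>y. y + Suc x) (seq_of r')"
      using Node.prems t x by (intro append_Cons_last_eq[of _ x]) auto
    moreover have "inj (\<lambda>y. y + k)" for k :: nat
      by simp
    ultimately have "seq_of l = seq_of l'" "seq_of r = seq_of r'"
      using inj_map_eq_map by blast+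
    then show ?case
      using Node.IH t x by simp
  qed
qed

lemma surj_seq_of: "\<exists>t. seq_of t = xs"
proof (induction "length xs" arbitrary: xs rule: less_induct)
  case less
  show ?case
  proof (cases "xs = []")
    case False
    define m where "m = Min (set xs)"
    have "m \<in> set xs" and min: "\<forall>y \<in> set xs. m \<le> y"
      using False by (auto simp: m_def)
    then obtain ys zs where xs: "xs = ys @ m # zs" "m \<notin> set zs"
      using split_list_last by metis
    \<comment> \<open>Because the last occurrence was chosen, \<open>zs\<close> lies strictly above
      \<open>m\<close>, and the truncated subtraction of \<open>Suc m\<close> below can be
      undone.\<close>
    have zs: "\<forall>z \<in> set zs. Suc m \<le> z"
      using min xs by (metis Suc_leI Un_iff le_neq_implies_less list.set_intros(2) set_append)
    obtain l where l: "seq_of l = map (\<lambda>y. y - m) ys"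
      using less[of "map (\<lambda>y. y - m) ys"] xs by auto
    obtain r where r: "seq_of r = map (\<lambda>y. y - Suc m) zs"
      using less[of "map (\<lambda>y. y - Suc m) zs"] xs by auto
    have "seq_of \<langle>l, m, r\<rangle> = xs"
      using min zs xs by (auto simp: l r intro!: map_idI)
    then show ?thesis ..
  qed (auto intro: exI[of _ "\<langle>\<rangle>"])
qed

section \<open>Trees and labeled Dyck paths\<close>

text \<open>The labels are left to \<open>preorder\<close>, which lists them in the order of the up
  steps: root, left subtree, right subtree.\<close>

fun path_of :: "'a tree \<Rightarrow> step list" where
  "path_of \<langle>\<rangle> = []"
| "path_of \<langle>l, x, r\<rangle> = U # path_of l @ D # path_of r"

lemma dyck_Nil [simp]: "dyck []"
  by (simp add: dyck_def)

lemma dyck_path_of [simp]: "dyck (path_of t)"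
  by (induction t) (auto simp: dyck_compose)

lemma length_path_of [simp]: "length (path_of t) = 2 * size t"
  by (induction t) auto

lemma path_of_eq_Nil_iff [simp]: "path_of t = [] \<longleftrightarrow> t = \<langle>\<rangle>"
  by (cases t) auto

lemma path_of_preorder_inj:
  "path_of s = path_of t \<Longrightarrow> preorder s = preorder t \<Longrightarrow> s = t"
proof (induction s arbitrary: t)
  case Leaf
  then show ?case by (metis path_of_eq_Nil_iff)
next
  case (Node l x r)
  obtain l' x' r' where t: "t = \<langle>l', x', r'\<rangle>"
    using Node.prems by (cases t) auto
  have p: "path_of l = path_of l'" "path_of r = path_of r'"
    using Node.prems(1) t fr_decomposition[OF dyck_path_of] by (metis path_of.simps(2))+
  \<comment> \<open>Equal sizes of the left subtrees make the two label lists split at the same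
    place.\<close>
  then have "size l = size l'"
    by (metis length_path_of mult_cancel1 zero_neq_numeral)
  then have "x = x'" "preorder l = preorder l'" "preorder r = preorder r'"
    using Node.prems(2) t by auto
  then show ?case
    using Node.IH p t by simp
qed

text \<open>Converse of \<open>dyck_compose\<close>: the path is cut at its first return to the
  axis, at position \<open>k\<close>.\<close>

lemma dyck_first_return_cases:
  assumes "dyck p" "p \<noteq> []"
  obtains q r where "p = U # q @ D # r" "dyck q" "dyck r"
proof -
  define k where "k = first_return p"
  have end_returns: "0 < length p \<and> height (take (length p) p) = 0"
    using assms by (simp add: dyck_def)
  then have "0 < k \<and> height (take k p) = 0"
    unfolding k_def first_return_def by (rule LeastI)
  moreover have "k \<le> length p"
    unfolding k_def first_return_def using end_returns by (rule Least_le)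
  ultimately have k: "0 < k" "height (take k p) = 0" "k \<le> length p"
    by simp_all
  have min: "height (take j p) \<noteq> 0" if "0 < j" "j < k" for j
    using not_less_Least[OF that(2)[unfolded k_def first_return_def]] that(1) by simp
  have nonneg: "0 \<le> height (take j p)" for j
    using assms(1) by (cases "j \<le> length p") (auto simp: dyck_def)
  obtain s p' where p: "p = s # p'"
    using assms(2) by (cases p) auto
  have s: "s = U"
    using nonneg[of 1] p by (cases s) auto
  have "k \<noteq> 1"
    using k(2) p s by auto
  then obtain m where m: "k = Suc (Suc m)"
    using k(1) by (metis One_nat_def gr0_implies_Suc old.nat.exhaust)
  have mp: "m < length p'"
    using k(3) m p by simp
  define q where "q = take m p'"
  define r where "r = drop (Suc m) p'"
  have p': "p' = q @ p' ! m # r"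
    using mp by (simp add: q_def r_def id_take_nth_drop)
  have len_q: "length q = m"
    using mp by (simp add: q_def)
  \<comment> \<open>Strictly before the first return the height is at least 1, and \<open>q\<close>
    starts at height 1.\<close>
  have q_pos: "0 \<le> height (take j q)" if "j \<le> m" for j
  proof -
    have "height (take (Suc j) p) = 1 + height (take j q)"
      using that p s by (simp add: q_def min_def)
    then show ?thesis
      using min[of "Suc j"] nonneg[of "Suc j"] that m by simp
  qed
  have "height (take k p) = 1 + height q + step_height (p' ! m)"
    using m mp p s by (simp add: q_def take_Suc_conv_app_nth)
  \<comment> \<open>The sum is 0 and \<open>height q\<close> is nonnegative, which forces a down
    step and \<open>height q = 0\<close>.\<close>
  with q_pos[of m] k(2) len_q have D: "p' ! m = D" and hq: "height q = 0"
    by (cases "p' ! m"; simp)+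
  have pd: "p = U # q @ D # r"
    using p s p' D by simp
  have "dyck q"
    using q_pos hq len_q by (simp add: dyck_def)
  moreover have "dyck r"
  proof -
    have "height (take (k + j) p) = height (take j r)" for j
      using pd m len_q hq by simp
    then have "0 \<le> height (take j r)" for j
      using nonneg by metis
    moreover have "height p = height r"
      using pd hq by simp
    ultimately show ?thesis
      using assms(1) by (simp add: dyck_def)
  qed
  ultimately show thesis
    using that pd by blast
qed

lemma dyck_even_length: "dyck p \<Longrightarrow> even (length p)"
proof (induction "length p" arbitrary: p rule: less_induct)
  case less
  show ?case
  proof (cases "p = []")
    case False
    with less.prems obtain q r where "p = U # q @ D # r" "dyck q" "dyck r"
      by (rule dyck_first_return_cases)
    then show ?thesis
      using less.hyps[of q] less.hyps[of r] by simp
  qed simp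
qed

lemma path_of_preorder_surj:
  assumes "dyck p" "length p = 2 * length lam"
  shows "\<exists>t. path_of t = p \<and> preorder t = lam"
  using assms
proof (induction "length p" arbitrary: p lam rule: less_induct)
  case less
  show ?case
  proof (cases "p = []")
    case True
    then show ?thesis
      using less.prems by (auto intro: exI[of _ "\<langle>\<rangle>"])
  next
    case False
    with less.prems obtain q r where p: "p = U # q @ D # r" "dyck q" "dyck r"
      by (blast elim: dyck_first_return_cases)
    obtain n where n: "length q = 2 * n"
      using dyck_even_length[OF p(2)] by blast
    obtain x mu where lam: "lam = x # mu"
      using less.prems p by (cases lam) auto
    have "length r + 2 * n = 2 * length mu"
      using less.prems p(1) n lam by simp
    then have len: "n \<le> length mu" "length r = 2 * length (drop n mu)"
      by simp_all
    have shorter: "length q < length p" "length r < length p"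
      using p(1) by simp_all
    \<comment> \<open>The labels after the first are cut at the semilength \<open>n\<close> of
      \<open>q\<close>, as in the preorder of a node.\<close>
    obtain l where l: "path_of l = q" "preorder l = take n mu"
      using less.hyps[OF shorter(1) p(2), of "take n mu"] n len by auto
    obtain l' where l': "path_of l' = r" "preorder l' = drop n mu"
      using less.hyps[OF shorter(2) p(3) len(2)] by auto
    show ?thesis
      using l l' p lam by (intro exI[of _ "\<langle>l, x, l'\<rangle>"]) simp
  qed
qed

section \<open>Transport of the statistics\<close>

lemma ret_Nil [simp]: "ret [] = 0"
  by (simp add: ret_def)

text \<open>After the initial up step the height stays at least 1 until the closing \<open>D\<close>
  at index \<open>Suc (length p)\<close>. All other returns are those of \<open>q\<close>, shifted
  by \<open>length p + 2\<close>.\<close>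

lemma ret_compose:
  assumes "dyck p"
  shows "ret (U # p @ D # q) = Suc (ret q)"
proof -
  let ?w = "U # p @ D # q"
  let ?R = "\<lambda>w. {i. i < length w \<and> w ! i = D \<and> height (take (Suc i) w) = 0}"
  have hp: "height p = 0"
    using assms by (simp add: dyck_def)
  have "?R ?w = insert (Suc (length p)) ((\<lambda>i. length p + 2 + i) ` ?R q)" (is "_ = ?S")
  proof (intro set_eqI iffI)
    fix i assume i: "i \<in> ?R ?w"
    show "i \<in> ?S"
    proof (cases "i \<le> length p")
      case True
      then have "height (take (Suc i) ?w) = 1 + height (take i p)"
        by simp
      moreover have "0 \<le> height (take i p)"
        using assms True by (simp add: dyck_def)
      ultimately show ?thesis
        using i by simp
    next
      case False
      then consider "i = Suc (length p)" | j where "i = length p + 2 + j"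
        by (metis add_2_eq_Suc' le_Suc_ex not_less_eq_eq le_antisym)
      then show ?thesis
      proof cases
        case 2
        then have "j \<in> ?R q"
          using i hp by (auto simp: nth_append)
        then show ?thesis
          using 2 by blast
      qed simp
    qed
  next
    fix i assume "i \<in> ?S"
    then show "i \<in> ?R ?w"
      using hp by (auto simp: nth_append)
  qed
  moreover have "card ?S = Suc (card (?R q))"
  proof -
    have "card ((\<lambda>i. length p + 2 + i) ` ?R q) = card (?R q)"
      by (rule card_image) (auto intro: inj_onI)
    moreover have "Suc (length p) \<notin> (\<lambda>i. length p + 2 + i) ` ?R q"
      by auto
    ultimately show ?thesis
      by (simp only: card_insert_disjoint finite_imageI finite_Collect_conjI finite_Collect_less_nat
          simp_thms)
  qed
  ultimately show ?thesis
    unfolding ret_def by (simp only:)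
qed

lemma ret_path_of_eq_0_iff: "ret (path_of t) = 0 \<longleftrightarrow> t = \<langle>\<rangle>"
  by (cases t) (auto simp: ret_compose)

text \<open>Both sides count the nodes on the right spine of the tree.\<close>

lemma rlmin_seq_of: "rlmin (seq_of t) = ret (path_of t)"
proof (induction t)
  case (Node l x r)
  have "rlmin (seq_of \<langle>l, x, r\<rangle>) = Suc (rlmin (map (\<lambda>y. y + Suc x) (seq_of r)))"
    unfolding seq_of.simps by (rule rlmin_append_min) auto
  also have "\<dots> = Suc (ret (path_of r))"
    using Node.IH(2) rlmin_map_add[of "Suc x"] by simp
  finally show ?case
    by (simp add: ret_compose)
qed simp

lemma last_path_of: "t \<noteq> \<langle>\<rangle> \<Longrightarrow> last (path_of t) = D"
  by (induction t) auto

lemma hd_path_of: "t \<noteq> \<langle>\<rangle> \<Longrightarrow> hd (path_of t) = U"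
  by (cases t) auto

text \<open>The initial \<open>U\<close> meets a \<open>D\<close> exactly when \<open>l\<close> is
  empty. A nonempty left path starts with \<open>U\<close> and ends with \<open>D\<close>, so its
  two junctions give no peak, and neither does the closing \<open>D\<close>.\<close>

lemma pk_path_of_Node:
  "pk (path_of \<langle>l, x, r\<rangle>) = (if l = \<langle>\<rangle> then 1 else pk (path_of l)) + pk (path_of r)"
  by (auto simp: pk_eq_adj_count adj_count_Cons adj_count_append hd_append hd_path_of last_path_of)

text \<open>The left block lies weakly above the root, so the step down to it is no ascent; the
  right block lies strictly above, so the step up to it always is one.\<close>

lemma asc_seq_of_Node:
  "asc (seq_of \<langle>l, x, r\<rangle>) = asc (seq_of l) + asc (seq_of r) + (if r = \<langle>\<rangle> then 0 else 1)"
  by (auto simp: asc_eq_adj_count adj_count_Cons adj_count_append adj_count_map hd_map last_map)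

text \<open>By the two recursions, \<open>asc\<close> counts the nodes with a right child and
  \<open>pk\<close> those without a left child. Every node except the root is a left or a right
  child, so the counts differ by one.\<close>

lemma asc_seq_of: "t \<noteq> \<langle>\<rangle> \<Longrightarrow> Suc (asc (seq_of t)) = pk (path_of t)"
proof (induction t)
  case (Node l x r)
  then show ?case
    unfolding asc_seq_of_Node pk_path_of_Node
    by (cases "l = \<langle>\<rangle>"; cases "r = \<langle>\<rangle>") (auto simp: asc_eq_adj_count pk_eq_adj_count)
qed simp

lemma lev_seq_of_Node:
  "lev (seq_of \<langle>l, x, r\<rangle>) = lev (seq_of l) + lev (seq_of r)
     + (if l \<noteq> \<langle>\<rangle> \<and> last (seq_of l) = 0 then 1 else 0)"
  by (auto simp: lev_eq_adj_count adj_count_Cons adj_count_append adj_count_map hd_map last_map)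

text \<open>A nonempty right subtree makes the last entry at least \<open>Suc x\<close> and adds a
  return. Without one, the path is primitive and the last entry is the root label, which is the
  label of the initial up step.\<close>

lemma lv_delta_path_of:
  "lv_delta (path_of t) (preorder t) = (if t \<noteq> \<langle>\<rangle> \<and> last (seq_of t) = 0 then 1 else 0)"
proof (cases t)
  case (Node l x r)
  then show ?thesis
    using ret_path_of_eq_0_iff[of r]
    by (auto simp: lv_delta_def primitive_def ret_compose last_map)
qed (simp add: lv_delta_def)

lemma lev_seq_of: "lev (seq_of t) = lv (path_of t) (preorder t)"
proof (induction t)
  case (Node l x r)
  then show ?case
    unfolding lev_seq_of_Node by (simp add: lv_compose lv_delta_path_of)
qed (simp add: lev_eq_adj_count lv_Nil)

section \<open>Counting Dyck paths\<close>

text \<open>Unequal numbers of up and down steps are allowed so that deleting the last letter stays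
  within the family.\<close>

definition ballot_words :: "nat \<Rightarrow> nat \<Rightarrow> step list set" where
  "ballot_words u d = {p. count_list p U = u \<and> count_list p D = d
     \<and> (\<forall>k \<le> length p. 0 \<le> height (take k p))}"

lemma height_eq_count: "height p = int (count_list p U) - int (count_list p D)"
proof (induction p)
  case (Cons s p)
  then show ?case by (cases s) auto
qed simp

lemma length_eq_count: "length p = count_list p U + count_list p D"
proof (induction p)
  case (Cons s p)
  then show ?case by (cases s) auto
qed simp

lemma dyck_paths_eq_ballot_words: "dyck_paths n = ballot_words n n"
  unfolding dyck_paths_def ballot_words_def dyck_def
  by (auto simp: height_eq_count length_eq_count)

text \<open>The only prefix of \<open>p @ [s]\<close> that is not a prefix of \<open>p\<close> is
  the whole word, whose height is u minus d.\<close>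

lemma ballot_words_snoc:
  "p @ [s] \<in> ballot_words u d \<longleftrightarrow> d \<le> u \<and>
     (case s of U \<Rightarrow> 0 < u \<and> p \<in> ballot_words (u - 1) d
              | D \<Rightarrow> 0 < d \<and> p \<in> ballot_words u (d - 1))"
proof -
  have "(\<forall>k \<le> Suc (length p). 0 \<le> height (take k (p @ [s])))
      \<longleftrightarrow> (\<forall>k \<le> length p. 0 \<le> height (take k p)) \<and> 0 \<le> height (p @ [s])"
    by (auto simp: le_Suc_eq)
  then show ?thesis
    by (cases s) (auto simp: ballot_words_def height_eq_count)
qed

lemma ballot_words_0_0: "ballot_words 0 0 = {[]}"
proof (rule set_eqI)
  fix p show "p \<in> ballot_words 0 0 \<longleftrightarrow> p \<in> {[]}"
    by (cases p rule: rev_cases)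
      (auto simp: ballot_words_snoc split: step.splits, simp add: ballot_words_def)
qed

lemma ballot_words_empty:
  assumes "u < d"
  shows "ballot_words u d = {}"
proof -
  have "p \<notin> ballot_words u d" for p
    using assms by (cases p rule: rev_cases)
      (auto simp: ballot_words_snoc, simp add: ballot_words_def)
  then show ?thesis by blast
qed

lemma ballot_words_Suc_0: "ballot_words (Suc u) 0 = (\<lambda>p. p @ [U]) ` ballot_words u 0"
proof (rule set_eqI)
  fix p show "p \<in> ballot_words (Suc u) 0 \<longleftrightarrow> p \<in> (\<lambda>p. p @ [U]) ` ballot_words u 0"
    by (cases p rule: rev_cases)
      (auto simp: ballot_words_snoc split: step.splits, simp add: ballot_words_def)
qed

lemma ballot_words_Suc_Suc:
  assumes "d \<le> u"
  shows "ballot_words (Suc u) (Suc d)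
    = (\<lambda>p. p @ [U]) ` ballot_words u (Suc d) \<union> (\<lambda>p. p @ [D]) ` ballot_words (Suc u) d"
proof (rule set_eqI)
  fix p show "p \<in> ballot_words (Suc u) (Suc d) \<longleftrightarrow> p \<in>
      (\<lambda>p. p @ [U]) ` ballot_words u (Suc d) \<union> (\<lambda>p. p @ [D]) ` ballot_words (Suc u) d"
    using assms by (cases p rule: rev_cases)
      (auto simp: ballot_words_snoc split: step.splits, simp add: ballot_words_def)
qed

lemma finite_ballot_words: "finite (ballot_words u d)"
proof (rule finite_subset)
  show "ballot_words u d \<subseteq> {p. set p \<subseteq> {U, D} \<and> length p = u + d}"
    by (auto simp: ballot_words_def length_eq_count intro: step.exhaust)
qed (simp add: finite_lists_length_eq)

text \<open>The ballot formula with denominators cleared. The boundary d = u + 1, where both sides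
  vanish, is included because deleting a final \<open>U\<close> from a word with d = u leads
  there.\<close>

lemma card_ballot_words:
  "d \<le> Suc u \<Longrightarrow> rat_of_nat (Suc u) * of_nat (card (ballot_words u d))
     = of_nat (Suc u - d) * of_nat ((u + d) choose d)"
proof (induction "u + d" arbitrary: u d rule: less_induct)
  case less
  show ?case
  proof (cases "d = Suc u")
    case True
    then show ?thesis by (simp add: ballot_words_empty)
  next
    case False
    with less.prems have du: "d \<le> u" by simp
    show ?thesis
    proof (cases d)
      case 0
      show ?thesis
      proof (cases u)
        case (Suc u')
        have "rat_of_nat (card (ballot_words u' 0)) = 1"
          using less.hyps[of u' 0] Suc 0 by simp
        then show ?thesis
          by (simp add: 0 Suc ballot_words_Suc_0 card_image inj_on_def)
      qed (simp add: 0 ballot_words_0_0)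
    next
      case (Suc e)
      then obtain v where u: "u = Suc v" and ev: "e \<le> v"
        using du by (cases u) auto
      have "card (ballot_words u d) = card (ballot_words v (Suc e)) + card (ballot_words (Suc v) e)"
        unfolding u Suc ballot_words_Suc_Suc[OF ev]
        by (subst card_Un_disjoint) (auto simp: finite_ballot_words card_image inj_on_def)
      moreover have "rat_of_nat (Suc v) * of_nat (card (ballot_words v (Suc e)))
          = (of_nat v - of_nat e) * of_nat ((v + Suc e) choose Suc e)"
        using less.hyps[of v "Suc e"] ev u Suc by (simp add: of_nat_diff)
      moreover have "rat_of_nat (Suc (Suc v)) * of_nat (card (ballot_words (Suc v) e))
          = (of_nat v + 2 - of_nat e) * of_nat ((v + Suc e) choose e)"
        using less.hyps[of "Suc v" e] ev u Suc by (simp add: of_nat_diff)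
      moreover have "rat_of_nat (Suc e) * of_nat ((v + Suc e) choose Suc e)
          = of_nat (Suc v) * of_nat ((v + Suc e) choose e)"
        using arg_cong[OF Suc_times_binomial_add[of e v], of rat_of_nat]
        by (simp only: of_nat_mult add.commute add_Suc_right)
      moreover have "(u + d) choose d = ((v + Suc e) choose Suc e) + ((v + Suc e) choose e)"
        by (simp add: u Suc)
      moreover have "rat_of_nat (Suc u - d) = of_nat v + 1 - of_nat e"
        using ev by (simp add: u Suc of_nat_diff)
      \<comment> \<open>\<open>A\<close> and \<open>B\<close> stand for the two smaller
        cardinalities, \<open>X\<close> and \<open>Y\<close> for the two terms of Pascal's rule.
        After multiplication by \<open>V + 1\<close> the claim is a polynomial consequence of the
        three relations.\<close>
      moreover have "(V + 2) * (A + B) = (V + 1 - E) * (X + Y)"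
        if "(V + 1) * A = (V - E) * X" "(V + 2) * B = (V + 2 - E) * Y" "(E + 1) * X = (V + 1) * Y"
          "V + 1 \<noteq> 0" for V E A B X Y :: rat
      proof -
        have "(V + 1) * ((V + 2) * (A + B)) = (V + 1) * ((V + 1 - E) * (X + Y))"
          using that(1-3) by algebra
        then show ?thesis
          using that(4) by (metis mult_cancel_left)
      qed
      moreover have "rat_of_nat v + 1 \<noteq> 0"
        by (metis of_nat_Suc of_nat_eq_0_iff nat.distinct(1) add.commute)
      ultimately show ?thesis
        by (simp add: u add.commute)
    qed
  qed
qed

lemma card_dyck_paths: "rat_of_nat (card (dyck_paths n)) = catalan n"
  using card_ballot_words[of n n]
  by (simp add: dyck_paths_eq_ballot_words catalan_def field_simps mult_2_right)

section \<open>Counting labelings and labeled Dyck paths\<close>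

lemma labeled_dyck_paths_eq:
  "labeled_dyck_paths n r = dyck_paths n \<times> {lam. length lam = n \<and> sum_list lam = r}"
  by (auto simp: labeled_dyck_paths_def)

lemma finite_length_sum_list: "finite {lam :: nat list. length lam = n \<and> sum_list lam = r}"
proof (rule finite_subset)
  show "{lam. length lam = n \<and> sum_list lam = r} \<subseteq> {lam. set lam \<subseteq> {..r} \<and> length lam = n}"
    using member_le_sum_list by fastforce
qed (simp add: finite_lists_length_eq)

lemma finite_labeled_dyck_paths: "finite (labeled_dyck_paths n r)"
  by (simp add: labeled_dyck_paths_eq dyck_paths_eq_ballot_words finite_ballot_words
      finite_length_sum_list)

lemma card_labeled_dyck_paths:
  assumes "1 \<le> n"
  shows "of_nat (card (labeled_dyck_paths n r)) = catalan n * of_nat ((r + n - 1) choose (n - 1))"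
proof -
  \<comment> \<open>Stars and bars gives the lower index \<open>r\<close>; symmetry turns it into
    \<open>n - 1\<close>.\<close>
  have "card {lam :: nat list. length lam = n \<and> sum_list lam = r} = (r + n - 1) choose (n - 1)"
    using assms binomial_symmetric[of r "r + n - 1"] by (simp add: card_length_sum_list)
  then show ?thesis
    by (simp add: labeled_dyck_paths_eq card_cartesian_product card_dyck_paths)
qed

section \<open>Labeled trees as the common source of both bijections, and the theorem\<close>

definition label_trees :: "nat \<Rightarrow> nat \<Rightarrow> nat tree set" where
  "label_trees n r = {t. size t = n \<and> sum_list (preorder t) = r}"

lemma bij_betw_seq_of:
  assumes "1 \<le> n"
  shows "bij_betw seq_of (label_trees n r) (exc_seqs n r)"
  unfolding bij_betw_def
proof
  show "inj_on seq_of (label_trees n r)"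
    using inj_seq_of by (rule inj_on_subset) simp
  \<comment> \<open>The leaf is ruled out by \<open>1 \<le> n\<close>: \<open>exc []\<close>
    involves the unspecified value \<open>[] ! 0\<close>.\<close>
  have "t \<in> label_trees n r \<longleftrightarrow> seq_of t \<in> exc_seqs n r" for t
    using assms by (cases "t = \<langle>\<rangle>") (auto simp: label_trees_def exc_seqs_def exc_seq_of)
  then show "seq_of ` label_trees n r = exc_seqs n r"
    using surj_seq_of by (auto simp: image_iff) metis
qed

lemma bij_betw_path_of_preorder:
  "bij_betw (\<lambda>t. (path_of t, preorder t)) (label_trees n r) (labeled_dyck_paths n r)"
  unfolding bij_betw_def
proof
  show "inj_on (\<lambda>t. (path_of t, preorder t)) (label_trees n r)"
    by (auto intro!: inj_onI path_of_preorder_inj)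
  have "\<exists>t \<in> label_trees n r. path_of t = p \<and> preorder t = lam"
    if "(p, lam) \<in> labeled_dyck_paths n r" for p lam
    using that path_of_preorder_surj[of p lam]
    by (auto simp: labeled_dyck_paths_def dyck_paths_def label_trees_def)
  then have "labeled_dyck_paths n r \<subseteq> (\<lambda>t. (path_of t, preorder t)) ` label_trees n r"
    by (auto simp: image_iff)
  moreover have "(\<lambda>t. (path_of t, preorder t)) ` label_trees n r \<subseteq> labeled_dyck_paths n r"
    by (auto simp: labeled_dyck_paths_def dyck_paths_def label_trees_def)
  ultimately show "(\<lambda>t. (path_of t, preorder t)) ` label_trees n r = labeled_dyck_paths n r"
    by blast
qed

theorem lemma3p1:
  fixes l r :: nat
  assumes "1 \<le> l"
  shows "(\<exists>\<Phi>. bij_betw \<Phi> (exc_seqs l r) (labeled_dyck_paths l r) \<and>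
            (\<forall>a \<in> exc_seqs l r. \<forall>p lam. \<Phi> a = (p, lam) \<longrightarrow>
               int (asc a) = int (pk p) - 1 \<and>
               lev a = lv p lam \<and>
               rlmin a = ret p \<and>
               lam ! 0 = Min (set a))) \<and>
         finite (exc_seqs l r) \<and>
         of_nat (card (exc_seqs l r)) = catalan l * of_nat ((r + l - 1) choose (l - 1))"
proof -
  let ?T = "label_trees l r" and ?g = "\<lambda>t. (path_of t, preorder t :: nat list)"
  \<comment> \<open>A sequence is taken back to its tree, from which the path and the labels are
    read off.\<close>
  define \<Phi> where "\<Phi> = ?g \<circ> inv_into ?T seq_of"
  note seq = bij_betw_seq_of[OF assms, of r]
  have bij: "bij_betw \<Phi> (exc_seqs l r) (labeled_dyck_paths l r)"
    unfolding \<Phi>_def using bij_betw_inv_into[OF seq] bij_betw_path_of_preorder by (rule bij_betw_trans)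
  moreover have "int (asc a) = int (pk p) - 1 \<and> lev a = lv p lam \<and> rlmin a = ret p
      \<and> lam ! 0 = Min (set a)"
    if a: "a \<in> exc_seqs l r" and \<Phi>: "\<Phi> a = (p, lam)" for a p lam
  proof -
    obtain t where t: "t \<in> ?T" "a = seq_of t"
      using a seq by (auto simp: bij_betw_def)
    then have "inv_into ?T seq_of a = t"
      using seq by (simp add: bij_betw_def)
    then have p: "p = path_of t" "lam = preorder t"
      using \<Phi> by (auto simp: \<Phi>_def)
    obtain t1 x t2 where Node: "t = \<langle>t1, x, t2\<rangle>"
      using t(1) assms by (cases t) (auto simp: label_trees_def)
    then have "lam ! 0 = Min (set a)"
      using p t Min_seq_of by simp
    then show ?thesis
      using asc_seq_of[of t] lev_seq_of[of t] rlmin_seq_of[of t] p t(2) Node by auto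
  qed
  ultimately show ?thesis
    using bij_betw_finite[OF bij] bij_betw_same_card[OF bij] finite_labeled_dyck_paths
      card_labeled_dyck_paths[OF assms] by auto
qed

end
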